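(* For any $\tau\in[2,\infty]$ there exist uncountably many elements $\xi\in\mathcal{C}$ with irrationality exponent $\tau(\xi)=\tau$.
   Context: $\mathbb{F}_3$ is the field with $3$ elements. $\mathbb{F}_3((X^{-1}))$ is the field of formal Laurent series $\sum_{n=-N}^{\infty}a_{-n}X^{-n}$ with $a_{-n}\in\mathbb{F}_3$, with ultrametric absolute value $|0|=0$ and $\left|\sum_{n=-N}^{\infty}a_{-n}X^{-n}\right|=3^N$ when $a_N\neq 0$; it is the completion of $\mathbb{F}_3(X)$ with respect to $|P|=3^{\deg P}$. The Cantor set is $\mathcal{C}=\{\sum_{n\ge 1}a_{-n}X^{-n}: a_{-n}\in\{0,2\}\text{ for all }n\}$. The irrationality exponent of $\xi\in\mathbb{F}_3((X^{-1}))$ is $$\tau(\xi)=\sup\left\{\tau:\left|\xi-\tfrac{g}{h}\right|<|h|^{-\tau}\text{ for infinitely many }\tfrac{g}{h}\in\mathbb{F}_3(X)\right\},$$ where $g,h\in\mathbb{F}_3[X]$, $h\ne0$. *)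

theory Defs
  imports
    "HOL-Computational_Algebra.Formal_Laurent_Series"
    "HOL-Computational_Algebra.Polynomial"
    "HOL-Library.Extended_Real"
    "HOL-Library.Countable_Set"
begin

text \<open>
  The field \<open>K((X\<^sup>-\<^sup>1))\<close> is represented by \<^typ>\<open>'a fls\<close>, whose indeterminate \<^const>\<open>fls_X\<close> plays
  the role of \<open>X\<^sup>-\<^sup>1\<close>. Hence \<open>fls_nth f n\<close> is the coefficient of \<open>X\<^sup>-\<^sup>n\<close>, the element \<open>X\<close> is
  \<^const>\<open>fls_X_inv\<close>, and a nonzero series with leading term in \<open>X\<^sup>N\<close> has subdegree \<open>-N\<close>.
  The base \<open>3\<close> of the absolute value is the cardinality of the field \<open>K\<close> of interest.
\<close>

definition laurent_abs :: "'a::field fls \<Rightarrow> real" where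
  "laurent_abs f = (if f = 0 then 0 else 3 powi (- fls_subdegree f))"

definition laurent_of_poly :: "'a::field poly \<Rightarrow> 'a fls" where
  "laurent_of_poly p = poly (map_poly fls_const p) fls_X_inv"

definition cantor_set :: "'a::field fls set" where
  "cantor_set = {f. (\<forall>n\<le>0. fls_nth f n = 0) \<and> (\<forall>n\<ge>1. fls_nth f n \<in> {0, 2})}"

text \<open>
  The approximations are counted as elements of \<open>K(X)\<close> (inside \<open>K((X\<^sup>-\<^sup>1))\<close>), not as pairs \<open>(g, h)\<close>.
\<close>

definition approximations :: "'a::field fls \<Rightarrow> real \<Rightarrow> 'a fls set" where
  "approximations \<xi> t =
     {laurent_of_poly g / laurent_of_poly h | g h.
        h \<noteq> 0 \<and>
        laurent_abs (\<xi> - laurent_of_poly g / laurent_of_poly h)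
          < laurent_abs (laurent_of_poly h) powr (- t)}"

definition irrationality_exponent :: "'a::field fls \<Rightarrow> ereal" where
  "irrationality_exponent \<xi> = Sup {ereal t | t. infinite (approximations \<xi> t)}"

end

theory Submission
  imports Defs
begin

text \<open>
  Since \<open>2 = - 1\<close> in a field with three elements, \<open>\<xi> = - (\<Sum>j. X ^ (- m j))\<close> lies in the Cantor set.
  If \<open>m (j + 1) > 2 * m j\<close>, the truncations of \<open>\<xi>\<close>, with denominators \<open>X ^ m j\<close>, are its best
  approximations: a folding argument shows that \<open>m (j + 1) \<le> \<tau> * m j + c\<close> for all \<open>j\<close> forces
  \<open>\<bar>\<xi> - g / h\<bar> \<ge> 3 ^ (- c) * \<bar>h\<bar> ^ (- \<tau>)\<close> for all \<open>g\<close> and \<open>h\<close>. So the exponent of \<open>\<xi>\<close> is the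
  limit of \<open>m (j + 1) / m j\<close>, and a free choice between two values of \<open>m (j + 1)\<close> at every step
  yields uncountably many series.
\<close>

section \<open>Absolute values of Laurent series\<close>

lemma laurent_abs_nonzero:
  "f \<noteq> 0 \<Longrightarrow> laurent_abs f = 3 powr (- real_of_int (fls_subdegree f))"
  using powr_real_of_int'[of 3 "- fls_subdegree f"] by (simp add: laurent_abs_def)

lemma laurent_abs_pos: "f \<noteq> 0 \<Longrightarrow> 0 < laurent_abs f"
  by (simp add: laurent_abs_nonzero)

lemma laurent_abs_mult: "laurent_abs (f * g) = laurent_abs f * laurent_abs g"
proof (cases "f = 0 \<or> g = 0")
  case False
  then show ?thesis
    by (simp add: laurent_abs_nonzero powr_add[symmetric])
qed (auto simp: laurent_abs_def)

lemma laurent_abs_divide: "g \<noteq> 0 \<Longrightarrow> laurent_abs (f / g) = laurent_abs f / laurent_abs g"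
  using laurent_abs_mult[of "f / g" g] laurent_abs_pos[of g] by (simp add: field_simps)

text \<open>The isosceles principle of the ultrametric: the smaller summand cannot cancel the
  leading term of the larger one.\<close>

lemma laurent_abs_add_eq:
  assumes "laurent_abs g < laurent_abs f"
  shows "laurent_abs (f + g) = laurent_abs f"
proof (cases "g = 0")
  case False
  have f: "f \<noteq> 0"
    using assms laurent_abs_pos[OF False] by (auto simp: laurent_abs_def[of f])
  then have lt: "fls_subdegree f < fls_subdegree g"
    using assms False by (simp add: laurent_abs_nonzero)
  then have "fls_subdegree (f + g) = fls_subdegree f"
    using f by (intro fls_subdegree_add_eq1)
  moreover have "f + g \<noteq> 0"
    using lt fls_uminus_subdegree[of g] by (auto simp: add_eq_0_iff)
  ultimately show ?thesis
    using f by (simp add: laurent_abs_nonzero)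
qed simp

lemma laurent_abs_le:
  assumes "\<And>k. k < n \<Longrightarrow> fls_nth f k = 0"
  shows "laurent_abs f \<le> 3 powr (- real_of_int n)"
proof (cases "f = 0")
  case False
  then have "n \<le> fls_subdegree f"
    using assms by (rule fls_subdegree_geI)
  then show ?thesis
    using False by (simp add: laurent_abs_nonzero)
qed (simp add: laurent_abs_def)

section \<open>Polynomials as Laurent series\<close>

lemma laurent_of_poly_0 [simp]: "laurent_of_poly 0 = 0"
  by (simp add: laurent_of_poly_def)

lemma laurent_of_poly_pCons:
  "laurent_of_poly (pCons a p) = fls_const a + fls_X_inv * laurent_of_poly p"
  by (simp add: laurent_of_poly_def map_poly_pCons)

lemma laurent_of_poly_nth:
  "fls_nth (laurent_of_poly p) n = (if n \<le> 0 then coeff p (nat (- n)) else 0)"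
proof (induction p arbitrary: n)
  case (pCons a p)
  have "nat (- n) = Suc (nat (- (n + 1)))" if "n < 0"
    using that by simp
  then show ?case
    using pCons.IH
    by (auto simp: laurent_of_poly_pCons fls_X_inv_times_conv_shift coeff_pCons split: nat.splits)
qed simp

lemma laurent_of_poly_add: "laurent_of_poly (p + q) = laurent_of_poly p + laurent_of_poly q"
  by (intro fls_eqI) (simp add: laurent_of_poly_nth)

lemma laurent_of_poly_diff: "laurent_of_poly (p - q) = laurent_of_poly p - laurent_of_poly q"
  by (intro fls_eqI) (simp add: laurent_of_poly_nth)

lemma laurent_of_poly_smult: "laurent_of_poly (smult a p) = fls_const a * laurent_of_poly p"
  by (intro fls_eqI) (simp add: laurent_of_poly_nth)

lemma laurent_of_poly_mult: "laurent_of_poly (p * q) = laurent_of_poly p * laurent_of_poly q"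
  by (induction p)
    (simp_all add: laurent_of_poly_add laurent_of_poly_smult laurent_of_poly_pCons algebra_simps)

lemma laurent_of_poly_monom: "laurent_of_poly (monom 1 n) = fls_X_inv ^ n"
  by (intro fls_eqI) (auto simp: laurent_of_poly_nth)

lemma laurent_of_poly_inject: "laurent_of_poly p = laurent_of_poly q \<longleftrightarrow> p = q"
proof
  assume eq: "laurent_of_poly p = laurent_of_poly q"
  show "p = q"
  proof (rule poly_eqI)
    fix n
    show "coeff p n = coeff q n"
      using arg_cong[OF eq, of "\<lambda>f. fls_nth f (- int n)"] by (simp add: laurent_of_poly_nth)
  qed
qed simp

lemma laurent_of_poly_eq_0_iff [simp]: "laurent_of_poly p = 0 \<longleftrightarrow> p = 0"
  using laurent_of_poly_inject[of p 0] by simp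

lemma laurent_abs_of_poly:
  assumes "p \<noteq> 0"
  shows "laurent_abs (laurent_of_poly p) = 3 powr real (degree p)"
proof -
  have "fls_subdegree (laurent_of_poly p) = - int (degree p)"
    using assms by (intro fls_subdegree_eqI) (auto simp: laurent_of_poly_nth coeff_eq_0)
  then show ?thesis
    using assms by (simp add: laurent_abs_nonzero)
qed

text \<open>The first \<open>n + 1\<close> coefficients, a list over a finite set, determine such a
  polynomial.\<close>

lemma finite_degree_le:
  assumes "finite (UNIV :: 'a::zero set)"
  shows "finite {p :: 'a poly. degree p \<le> n}"
proof (rule finite_imageD)
  show "finite ((\<lambda>p. map (coeff p) [0..<Suc n]) ` {p :: 'a poly. degree p \<le> n})"
    by (rule finite_subset[OF _ finite_lists_length_eq[OF assms, of "Suc n"]]) auto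
  show "inj_on (\<lambda>p. map (coeff p) [0..<Suc n]) {p :: 'a poly. degree p \<le> n}"
  proof (rule inj_onI)
    fix p q :: "'a poly"
    assume deg: "p \<in> {p. degree p \<le> n}" "q \<in> {p. degree p \<le> n}"
      and eq: "map (coeff p) [0..<Suc n] = map (coeff q) [0..<Suc n]"
    have "coeff p i = coeff q i" for i
    proof (cases "i \<le> n")
      case True
      then show ?thesis using eq by (simp add: map_eq_conv del: upt_Suc)
    next
      case False
      then show ?thesis using deg by (simp add: coeff_eq_0)
    qed
    then show "p = q" by (rule poly_eqI)
  qed
qed

section \<open>Folding\<close>

text \<open>With \<open>r = h * p - g * X ^ m\<close> one has \<open>\<bar>p / X ^ m - g / h\<bar> =
  3 ^ (degree r - m - degree h)\<close>, so the inequality says \<open>\<bar>p / X ^ m - g / h\<bar>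
  \<ge> 3 ^ (- c) * \<bar>h\<bar> ^ (- \<tau>)\<close>. Since \<open>degree 0 = 0\<close>,
  \<open>r \<noteq> 0\<close> is a separate demand; it must fail at
  \<open>h = X ^ m\<close>.\<close>

definition approx_bound :: "real \<Rightarrow> real \<Rightarrow> 'a::field poly \<Rightarrow> nat \<Rightarrow> bool" where
  "approx_bound \<tau> c p m \<longleftrightarrow>
     (\<forall>h g. h \<noteq> 0 \<longrightarrow> degree h < m \<longrightarrow>
        h * p - g * monom 1 m \<noteq> 0 \<and>
        real m - real (degree (h * p - g * monom 1 m)) \<le> (\<tau> - 1) * real (degree h) + c)"

lemma approx_boundD:
  assumes "approx_bound \<tau> c p m" "h \<noteq> 0" "degree h < m"
  shows "h * p - g * monom 1 m \<noteq> 0"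
    and "real m - real (degree (h * p - g * monom 1 m)) \<le> (\<tau> - 1) * real (degree h) + c"
  using assms unfolding approx_bound_def by blast+

lemma degree_monom_mult_diff:
  fixes s h :: "'a::field poly"
  assumes "s \<noteq> 0" "degree h < l"
  shows "degree (monom 1 l * s - h) = l + degree s"
proof -
  have deg: "degree (monom 1 l * s) = l + degree s"
    using assms(1) by (simp add: degree_mult_eq degree_monom_eq)
  then have "degree (monom 1 l * s + - h) = l + degree s"
    using assms(2) by (subst degree_add_eq_left) auto
  then show ?thesis by simp
qed

text \<open>
  For large \<open>degree h\<close> the pair \<open>(h, r)\<close> is exchanged with \<open>(r, - h)\<close>: modulo \<open>X ^ M\<close> the numerator
  \<open>p * X ^ (M - m) - 1\<close> has the inverse \<open>- (p * X ^ (M - m) + 1)\<close>, so that \<open>r\<close> is a small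
  denominator for the truncation with numerator \<open>p\<close>.
\<close>

lemma approx_bound_fold:
  fixes p :: "'a::field poly"
  assumes bound: "approx_bound \<tau> c p m" and \<tau>: "2 \<le> \<tau>" and c: "0 \<le> c"
    and mM: "2 * m \<le> M" and M: "real M \<le> \<tau> * real m + c"
  shows "approx_bound \<tau> c (p * monom 1 (M - m) - 1) M"
  unfolding approx_bound_def
proof (intro allI impI)
  fix h g :: "'a poly"
  assume h: "h \<noteq> 0" and dM: "degree h < M"
  define l where "l = M - m"
  define r where "r = h * (p * monom 1 l - 1) - g * monom 1 M"
  define s where "s = h * p - g * monom 1 m"
  define d where "d = degree h"
  have Mlm: "M = l + m" and ml: "m \<le> l"
    using mM by (auto simp: l_def)
  have monom_M: "monom 1 M = monom 1 l * (monom 1 m :: 'a poly)"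
    by (simp add: mult_monom Mlm)
  \<comment> \<open>The new remainder \<open>r\<close> in terms of the old one \<open>s\<close>: for
    \<open>d < l\<close> and \<open>s \<noteq> 0\<close>, \<open>h\<close> does not affect the
    degree, and \<open>M - degree r = m - degree s\<close>.\<close>
  have r_s: "r = monom 1 l * s - h"
    unfolding r_def s_def monom_M by (simp add: algebra_simps)
  have d_le: "real d \<le> (\<tau> - 1) * real d"
    using \<tau> mult_right_mono[of 1 "\<tau> - 1" "real d"] by simp
  have "r \<noteq> 0 \<and> real M - real (degree r) \<le> (\<tau> - 1) * real d + c"
  proof (cases "d < l")
    case dl: True
    show ?thesis
    proof (cases "s = 0")
      case True
      then have "m \<le> d"
        using approx_boundD(1)[OF bound h, of g] by (auto simp: s_def d_def not_less[symmetric])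
      \<comment> \<open>Here \<open>r = - h\<close>, and \<open>m \<le> d\<close> turns the growth
        hypothesis into \<open>M \<le> \<tau> * d + c\<close>.\<close>
      then have "\<tau> * real m \<le> \<tau> * real d"
        using \<tau> by (intro mult_left_mono) auto
      then have "real M - real d \<le> (\<tau> - 1) * real d + c"
        using M by (simp add: algebra_simps)
      then show ?thesis
        using True h by (simp add: r_s d_def)
    next
      case False
      have deg: "degree r = l + degree s"
        unfolding r_s using degree_monom_mult_diff[OF False] dl by (simp add: d_def)
      have "real m - real (degree s) \<le> (\<tau> - 1) * real d + c"
      proof (cases "d < m")
        case True
        then show ?thesis
          using approx_boundD(2)[OF bound h, of g] by (simp add: s_def d_def)
      next
        case False
        then show ?thesis using d_le c by linarith
      qed
      moreover have "r \<noteq> 0"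
      proof
        assume "r = 0"
        then have "l = 0" using deg by simp
        then show False using dl by simp
      qed
      ultimately show ?thesis
        using deg by (simp add: Mlm)
    qed
  next
    case False
    then have ld: "l \<le> d" by simp
    \<comment> \<open>\<open>G\<close> comes from multiplying \<open>r\<close> by
      \<open>p * X ^ l + 1\<close>: as \<open>X ^ (2 * l) = X ^ M * X ^ (l - m)\<close>, the product
      is \<open>X ^ M * G - h\<close>. Then \<open>u\<close> is the remainder of the old numerator
      \<open>p\<close> for the denominator \<open>r\<close>.\<close>
    define G where "G = h * p * p * monom 1 (l - m) - g * (p * monom 1 l + 1)"
    define u where "u = r * p - G * monom 1 m"
    have monom_l: "monom 1 l = monom 1 m * (monom 1 (l - m) :: 'a poly)"
      using ml by (simp add: mult_monom)
    have h_G: "h = monom 1 M * G - r * (p * monom 1 l + 1)"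
      unfolding r_def G_def monom_M monom_l by (simp add: algebra_simps)
    then have h_u: "h = - (monom 1 l * u - (- r))"
      unfolding u_def monom_M by (simp add: algebra_simps)
    have r: "r \<noteq> 0"
    proof
      assume "r = 0"
      then have eq: "h = monom 1 M * G"
        using h_G by simp
      then have "G \<noteq> 0" using h by auto
      then have "degree h = M + degree G"
        unfolding eq by (simp add: degree_mult_eq degree_monom_eq)
      then show False using dM by simp
    qed
    have "real M - real (degree r) \<le> (\<tau> - 1) * real d + c"
    proof (cases "M \<le> d + degree r")
      case True
      then show ?thesis using d_le c by linarith
    next
      case False
      \<comment> \<open>\<open>degree r < M - d \<le> M - l = m \<le> l \<le> d\<close>.\<close>
      then have rm: "degree r < m" and rl: "degree r < l" and rd: "degree r \<le> d"
        using ld Mlm ml by auto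
      have u: "u \<noteq> 0" and ub: "real m - real (degree u) \<le> (\<tau> - 1) * real (degree r) + c"
        using approx_boundD[OF bound r rm, of G] by (simp_all add: u_def)
      have "degree h = degree (monom 1 l * u - (- r))"
        using h_u by (metis degree_minus)
      then have "d = l + degree u"
        using degree_monom_mult_diff[OF u, of "- r" l] rl by (simp add: d_def)
      then have "real M - real d \<le> (\<tau> - 1) * real (degree r) + c"
        using ub by (simp add: Mlm)
      \<comment> \<open>\<open>M - degree r = (M - d) + (d - degree r) \<le> (\<tau> - 2) * degree r
        + d + c\<close>, where \<open>degree r\<close> may be raised to \<open>d\<close> because
        \<open>2 \<le> \<tau>\<close>.\<close>
      moreover have "(\<tau> - 2) * real (degree r) \<le> (\<tau> - 2) * real d"
        using \<tau> rd by (intro mult_left_mono) auto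
      ultimately show ?thesis by (simp add: algebra_simps)
    qed
    then show ?thesis using r by blast
  qed
  then show "h * (p * monom 1 (M - m) - 1) - g * monom 1 M \<noteq> 0 \<and>
      real M - real (degree (h * (p * monom 1 (M - m) - 1) - g * monom 1 M))
        \<le> (\<tau> - 1) * real (degree h) + c"
    unfolding r_def l_def d_def .
qed

section \<open>Lacunary series\<close>

text \<open>The digit is written \<open>- 1\<close> because folding works with this sign over every
  field; it becomes the Cantor digit \<open>2\<close> only when the field has three
  elements.\<close>

definition lacunary :: "(nat \<Rightarrow> nat) \<Rightarrow> 'a::field fls" where
  "lacunary m = fps_to_fls (Abs_fps (\<lambda>n. if n \<in> range m then - 1 else 0))"

text \<open>Horner's scheme for the numerator, over \<open>X ^ m j\<close>, of the partial sum up to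
  index \<open>j\<close> when \<open>m\<close> increases. Each step has the shape handled by
  \<open>approx_bound_fold\<close>.\<close>

primrec truncation_num :: "(nat \<Rightarrow> nat) \<Rightarrow> nat \<Rightarrow> 'a::field poly" where
  "truncation_num m 0 = - 1"
| "truncation_num m (Suc j) = truncation_num m j * monom 1 (m (Suc j) - m j) - 1"

lemma lacunary_nth_int: "fls_nth (lacunary m) (int n) = (if n \<in> range m then - 1 else 0)"
  by (simp add: lacunary_def)

lemma lacunary_nth:
  "fls_nth (lacunary m) n = (if n \<in> range (\<lambda>i. int (m i)) then - 1 else 0)"
proof (cases "0 \<le> n")
  case True
  then have "nat n \<in> range m \<longleftrightarrow> n \<in> range (\<lambda>i. int (m i))"
    by (auto simp: image_iff) (metis int_nat_eq)
  then show ?thesis using True by (auto simp: lacunary_def)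
qed (auto simp: lacunary_def)

locale doubling_sequence =
  fixes m :: "nat \<Rightarrow> nat"
  assumes m_0: "m 0 = 1" and m_Suc: "2 * m j < m (Suc j)"
begin

lemma strict_mono_m: "strict_mono m"
  unfolding strict_mono_Suc_iff
proof
  fix n show "m n < m (Suc n)" using m_Suc[of n] by simp
qed

lemma m_pos: "0 < m j"
  using m_0 strict_mono_less_eq[OF strict_mono_m, of 0 j] by simp

lemma lacunary_tail_nth:
  "fls_nth ((lacunary m :: 'a::field fls) * fls_X_inv ^ m j - laurent_of_poly (truncation_num m j)) n
     = (if n + int (m j) \<in> (\<lambda>i. int (m i)) ` {j<..} then - 1 else 0)"
proof (induction j arbitrary: n)
  case 0
  have "range (\<lambda>i. int (m i)) = insert 1 ((\<lambda>i. int (m i)) ` {0<..})"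
  proof -
    have UNIV_insert: "(UNIV :: nat set) = insert 0 {0<..}" by auto
    show ?thesis unfolding UNIV_insert image_insert m_0 of_nat_1 ..
  qed
  moreover have "1 \<notin> (\<lambda>i. int (m i)) ` {0<..}"
  proof
    assume "1 \<in> (\<lambda>i. int (m i)) ` {0<..}"
    then obtain i where "0 < i" "m i = 1" by force
    then show False
      using strict_mono_less[OF strict_mono_m, of 0 i] m_0 by simp
  qed
  ultimately show ?case
    by (auto simp: fls_X_inv_times_conv_shift laurent_of_poly_nth lacunary_nth m_0)
next
  case (Suc j)
  define l where "l = m (Suc j) - m j"
  have l: "m (Suc j) = m j + l"
    using m_Suc[of j] by (simp add: l_def)
  define T where "T = lacunary m * fls_X_inv ^ m j - laurent_of_poly (truncation_num m j :: 'a poly)"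
  \<comment> \<open>The \<open>- 1\<close> in the Horner step becomes \<open>+ 1\<close> here; it
    cancels the leading coefficient of the shifted tail, which belongs to the index
    \<open>Suc j\<close>.\<close>
  have "(lacunary m :: 'a fls) * fls_X_inv ^ m (Suc j) - laurent_of_poly (truncation_num m (Suc j))
      = T * fls_X_inv ^ l + laurent_of_poly 1"
    by (simp add: T_def l laurent_of_poly_diff laurent_of_poly_mult laurent_of_poly_monom
        power_add algebra_simps)
  then have nth: "fls_nth (lacunary m * fls_X_inv ^ m (Suc j)
        - laurent_of_poly (truncation_num m (Suc j) :: 'a poly)) n
      = fls_nth T (n + int l) + (if n = 0 then 1 else 0)"
    by (auto simp: fls_X_inv_power_times_conv_shift laurent_of_poly_nth)
  have split: "{j<..} = insert (Suc j) {Suc j<..}"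
    by auto
  have notin: "int (m (Suc j)) \<notin> (\<lambda>i. int (m i)) ` {Suc j<..}"
  proof
    assume "int (m (Suc j)) \<in> (\<lambda>i. int (m i)) ` {Suc j<..}"
    then obtain i where "Suc j < i" "m i = m (Suc j)" by force
    then show False
      using strict_mono_less[OF strict_mono_m, of "Suc j" i] by simp
  qed
  have shift: "n + int l + int (m j) = n + int (m (Suc j))"
    by (simp add: l)
  show ?case
    unfolding nth T_def Suc.IH shift split using notin by auto
qed

lemma lacunary_tail_abs:
  "laurent_abs ((lacunary m :: 'a::field fls) * fls_X_inv ^ m j - laurent_of_poly (truncation_num m j))
     \<le> 3 powr (real (m j) - real (m (Suc j)))"
proof -
  have "fls_nth ((lacunary m :: 'a fls) * fls_X_inv ^ m j - laurent_of_poly (truncation_num m j)) k = 0"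
    if "k < int (m (Suc j)) - int (m j)" for k
  proof -
    have "k + int (m j) < int (m i)" if "j < i" for i
      using \<open>k < _\<close> strict_mono_less_eq[OF strict_mono_m, of "Suc j" i] that by simp
    then show ?thesis unfolding lacunary_tail_nth by force
  qed
  then show ?thesis
    using laurent_abs_le[of "int (m (Suc j)) - int (m j)"] by fastforce
qed

section \<open>Truncations as good approximations\<close>

lemma coeff_truncation_num_0: "coeff (truncation_num m j) 0 = - 1"
proof (cases j)
  case (Suc i)
  have "0 < m (Suc i) - m i" using m_Suc[of i] by simp
  then show ?thesis using Suc by (simp add: coeff_mult)
qed simp

definition truncation :: "nat \<Rightarrow> 'a::field fls" where
  "truncation j = laurent_of_poly (truncation_num m j) / laurent_of_poly (monom 1 (m j))"

text \<open>Approximations are counted as field elements, so infinitely many indices must yield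
  infinitely many values.\<close>

lemma inj_truncation: "inj (truncation :: nat \<Rightarrow> 'a::field fls)"
proof (rule linorder_injI)
  fix i j :: nat
  assume ij: "i < j"
  then have lt: "m i < m j" using strict_mono_m by (simp add: strict_mono_less)
  show "truncation i \<noteq> (truncation j :: 'a fls)"
  proof
    assume "truncation i = (truncation j :: 'a fls)"
    then have "truncation_num m i * monom 1 (m j) = truncation_num m j * (monom 1 (m i) :: 'a poly)"
      unfolding truncation_def
      by (simp add: frac_eq_eq laurent_of_poly_mult[symmetric] laurent_of_poly_inject)
    \<comment> \<open>At \<open>X ^ m i\<close> the left side has coefficient 0, since
      \<open>m i < m j\<close>, and the right side has the constant term \<open>- 1\<close> of the
      numerator.\<close>
    then have "coeff (monom 1 (m j) * truncation_num m i) (m i)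
        = coeff (monom 1 (m i) * (truncation_num m j :: 'a poly)) (m i)"
      by (simp add: mult.commute)
    then show False
      using lt by (simp add: coeff_monom_mult coeff_truncation_num_0)
  qed
qed

lemma lacunary_minus_truncation_abs:
  "laurent_abs ((lacunary m :: 'a::field fls) - truncation j) \<le> 3 powr (- real (m (Suc j)))"
proof -
  let ?X = "laurent_of_poly (monom 1 (m j)) :: 'a fls"
  have X: "?X \<noteq> 0" by simp
  have abs_X: "laurent_abs ?X = 3 powr real (m j)"
    by (simp add: laurent_abs_of_poly degree_monom_eq)
  have "(lacunary m :: 'a fls) - truncation j
      = (lacunary m * ?X - laurent_of_poly (truncation_num m j)) / ?X"
    using X by (simp add: truncation_def field_simps)
  then have "laurent_abs ((lacunary m :: 'a fls) - truncation j)
      = laurent_abs (lacunary m * ?X - laurent_of_poly (truncation_num m j)) / 3 powr real (m j)"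
    by (simp only: laurent_abs_divide[OF X] abs_X)
  also have "\<dots> \<le> 3 powr (real (m j) - real (m (Suc j))) / 3 powr real (m j)"
    unfolding laurent_of_poly_monom by (intro divide_right_mono lacunary_tail_abs) simp
  finally show ?thesis by (simp add: powr_diff[symmetric])
qed

lemma truncation_in_approximations:
  assumes "t * real (m j) < real (m (Suc j))"
  shows "truncation j \<in> approximations (lacunary m) t"
proof -
  have "laurent_abs (lacunary m - truncation j) \<le> 3 powr (- real (m (Suc j)))"
    by (rule lacunary_minus_truncation_abs)
  also have "\<dots> < 3 powr (- (t * real (m j)))"
    using assms by simp
  also have "\<dots> = laurent_abs (laurent_of_poly (monom 1 (m j))) powr (- t)"
    by (simp add: laurent_abs_of_poly degree_monom_eq powr_powr mult.commute)
  finally show ?thesis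
    unfolding approximations_def truncation_def by fastforce
qed

lemma infinite_approximations:
  assumes "\<forall>\<^sub>F j in sequentially. t * real (m j) < real (m (Suc j))"
  shows "infinite (approximations (lacunary m :: 'a::field fls) t)"
proof -
  obtain N where N: "\<And>j. N \<le> j \<Longrightarrow> t * real (m j) < real (m (Suc j))"
    using assms by (auto simp: eventually_sequentially)
  have "infinite ((truncation :: nat \<Rightarrow> 'a fls) ` {N..})"
    using inj_truncation infinite_Ici by (auto dest!: finite_imageD intro: inj_on_subset)
  then show ?thesis
    by (rule infinite_super[rotated]) (auto intro: truncation_in_approximations N)
qed

section \<open>Lower bounds for arbitrary approximations\<close>

lemma approx_bound_truncation:
  assumes "2 \<le> \<tau>" "1 \<le> c" "\<And>j. real (m (Suc j)) \<le> \<tau> * real (m j) + c"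
  shows "approx_bound \<tau> c (truncation_num m j :: 'a::field poly) (m j)"
proof (induction j)
  case 0
  \<comment> \<open>As \<open>m 0 = 1\<close>, only constant \<open>h\<close> occur; the bound
    itself then follows from \<open>1 \<le> c\<close>.\<close>
  have "h * (- 1) - g * monom 1 1 \<noteq> 0" if "h \<noteq> 0" "degree h = 0" for h g :: "'a poly"
  proof
    assume "h * (- 1) - g * monom 1 1 = 0"
    then have "coeff (h * (- 1) - monom 1 1 * g) 0 = 0"
      by (simp add: mult.commute)
    then have "coeff h 0 = 0" by (simp add: coeff_monom_mult)
    then show False using that leading_coeff_0_iff[of h] by simp
  qed
  then show ?case
    using assms(2) by (auto simp: approx_bound_def m_0)
next
  case (Suc j)
  show ?case
    unfolding truncation_num.simps
    using assms m_Suc[of j] by (intro approx_bound_fold[OF Suc.IH]) auto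
qed

text \<open>The bound passes from a truncation to the series: after scaling by
  \<open>X ^ m j\<close>, the tail contributes less than 1, while the nonzero polynomial remainder
  has absolute value at least 1.\<close>

lemma lacunary_approx_bound:
  fixes h g :: "'a::field poly"
  assumes "2 \<le> \<tau>" "1 \<le> c" "\<And>j. real (m (Suc j)) \<le> \<tau> * real (m j) + c" and h: "h \<noteq> 0"
  shows "3 powr (- ((\<tau> - 1) * real (degree h) + c))
    \<le> laurent_abs (lacunary m * laurent_of_poly h - laurent_of_poly g)"
proof -
  define j where "j = Suc (degree h)"
  have "j \<le> m j" by (rule strict_mono_imp_increasing[OF strict_mono_m])
  then have dm: "degree h < m j" by (simp add: j_def)
  define r where "r = h * truncation_num m j - g * monom 1 (m j)"
  define T where "T = lacunary m * fls_X_inv ^ m j - laurent_of_poly (truncation_num m j :: 'a poly)"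
  note bound = approx_boundD[OF approx_bound_truncation[OF assms(1-3)] h dm, of g, folded r_def]
  have abs_r: "laurent_abs (laurent_of_poly r) = 3 powr real (degree r)"
    using bound(1) by (rule laurent_abs_of_poly)
  have "laurent_abs (T * laurent_of_poly h)
      \<le> 3 powr (real (m j) - real (m (Suc j))) * 3 powr real (degree h)"
    unfolding laurent_abs_mult laurent_abs_of_poly[OF h] T_def
    by (intro mult_right_mono lacunary_tail_abs) simp
  also have "\<dots> = 3 powr (real (m j) - real (m (Suc j)) + real (degree h))"
    by (simp add: powr_add)
  \<comment> \<open>Doubling gives \<open>m j - m (Suc j) < - m j\<close>, and
    \<open>degree h < m j\<close>.\<close>
  also have "\<dots> < 3 powr 0"
    using dm m_Suc[of j] by (intro powr_less_mono) auto
  also have "\<dots> \<le> laurent_abs (laurent_of_poly r)"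
    unfolding abs_r by (intro powr_mono) auto
  finally have "laurent_abs (laurent_of_poly r + T * laurent_of_poly h) = 3 powr real (degree r)"
    using abs_r by (simp add: laurent_abs_add_eq)
  moreover have "laurent_of_poly r + T * laurent_of_poly h
      = (lacunary m * laurent_of_poly h - laurent_of_poly g) * laurent_of_poly (monom 1 (m j))"
    by (simp add: r_def T_def laurent_of_poly_diff laurent_of_poly_mult laurent_of_poly_monom
        algebra_simps)
  ultimately have "laurent_abs (lacunary m * laurent_of_poly h - laurent_of_poly g)
      * 3 powr real (m j) = 3 powr real (degree r)"
    by (simp add: laurent_abs_mult laurent_abs_of_poly degree_monom_eq)
  then have "laurent_abs (lacunary m * laurent_of_poly h - laurent_of_poly g)
      = 3 powr (real (degree r) - real (m j))"
    by (simp add: powr_diff field_simps)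
  then show ?thesis using bound(2) by simp
qed

lemma finite_approximations:
  assumes "finite (UNIV :: 'a::field set)"
    and \<tau>: "2 \<le> \<tau>" "1 \<le> c" "\<And>j. real (m (Suc j)) \<le> \<tau> * real (m j) + c" and t: "\<tau> < t"
  shows "finite (approximations (lacunary m :: 'a fls) t)"
proof -
  \<comment> \<open>The lower bound and the assumed approximation quality together give
    \<open>(t - \<tau>) * degree h < c\<close>.\<close>
  define D where "D = nat \<lceil>c / (t - \<tau>)\<rceil>"
  let ?P = "{p :: 'a poly. degree p \<le> D}"
  have "approximations (lacunary m :: 'a fls) t
      \<subseteq> (\<lambda>(g, h). laurent_of_poly g / laurent_of_poly h) ` (?P \<times> ?P)"
  proof
    fix x :: "'a fls"
    assume "x \<in> approximations (lacunary m) t"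
    then obtain g h :: "'a poly" where x: "x = laurent_of_poly g / laurent_of_poly h"
      and h: "h \<noteq> 0"
      and lt: "laurent_abs (lacunary m - laurent_of_poly g / laurent_of_poly h)
                 < laurent_abs (laurent_of_poly h) powr (- t)"
      unfolding approximations_def by blast
    let ?d = "real (degree h)"
    let ?e = "lacunary m * laurent_of_poly h - laurent_of_poly g :: 'a fls"
    have "lacunary m - laurent_of_poly g / laurent_of_poly h = ?e / laurent_of_poly h"
      using h by (simp add: field_simps)
    then have "laurent_abs ?e / 3 powr ?d < 3 powr (- t * ?d)"
      using lt h by (simp add: laurent_abs_divide laurent_abs_of_poly powr_powr mult.commute)
    then have small: "laurent_abs ?e < 3 powr (?d - t * ?d)"
      by (simp add: powr_diff powr_minus field_simps)
    moreover have "3 powr (- ((\<tau> - 1) * ?d + c)) \<le> laurent_abs ?e"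
      by (rule lacunary_approx_bound[OF \<tau> h])
    ultimately have "(3::real) powr (- ((\<tau> - 1) * ?d + c)) < 3 powr (?d - t * ?d)"
      by linarith
    then have "(t - \<tau>) * ?d < c"
      by (simp add: algebra_simps)
    then have "?d < c / (t - \<tau>)"
      using t by (simp add: field_simps)
    then have dD: "degree h \<le> D"
      unfolding D_def by linarith
    \<comment> \<open>As \<open>\<bar>\<xi>\<bar> \<le> 1\<close>, a numerator of larger degree than
      \<open>h\<close> would give the error
      \<open>\<bar>\<xi> * h - g\<bar> = \<bar>g\<bar> > \<bar>h\<bar>\<close>.\<close>
    have "degree g \<le> D"
    proof (rule ccontr)
      assume "\<not> degree g \<le> D"
      then have deg: "degree h < degree g" and g: "g \<noteq> 0"
        using dD by auto
      have "laurent_abs (lacunary m :: 'a fls) \<le> 3 powr (- real_of_int 0)"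
        using m_pos by (intro laurent_abs_le) (auto simp: lacunary_nth)
      then have "laurent_abs (lacunary m * laurent_of_poly h) \<le> 3 powr ?d"
        unfolding laurent_abs_mult laurent_abs_of_poly[OF h]
        using mult_right_mono[of _ 1 "3 powr ?d"] by simp
      also have lt_g: "\<dots> < laurent_abs (laurent_of_poly (- g))"
        using deg g by (simp add: laurent_abs_of_poly)
      finally have "laurent_abs (laurent_of_poly (- g) + lacunary m * laurent_of_poly h)
          = laurent_abs (laurent_of_poly (- g))"
        by (rule laurent_abs_add_eq)
      moreover have "laurent_of_poly (- g) + lacunary m * laurent_of_poly h = ?e"
        using laurent_of_poly_diff[of 0 g] by simp
      ultimately have "3 powr ?d < laurent_abs ?e"
        using lt_g by simp
      also have "\<dots> \<le> 3 powr ?d"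
      proof -
        have "0 \<le> t * ?d" using \<tau> t by (intro mult_nonneg_nonneg) auto
        then have "(3::real) powr (?d - t * ?d) \<le> 3 powr ?d" by (intro powr_mono) auto
        then show ?thesis using small by linarith
      qed
      finally show False by simp
    qed
    then show "x \<in> (\<lambda>(g, h). laurent_of_poly g / laurent_of_poly h) ` (?P \<times> ?P)"
      using x dD by auto
  qed
  then show ?thesis
    using finite_degree_le[OF assms(1), of D] by (auto intro: finite_subset)
qed

end

section \<open>Prescribed exponents\<close>

text \<open>The infinite case is separate because \<open>real_of_ereal \<infinity> = 0\<close>; its
  factor \<open>j + 2\<close> is at least 2 and unbounded.\<close>

definition growth :: "ereal \<Rightarrow> nat \<Rightarrow> nat \<Rightarrow> nat" where
  "growth \<tau> j n = (if \<tau> = \<infinity> then (j + 2) * n else nat \<lfloor>real_of_ereal \<tau> * real n\<rfloor>)"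

text \<open>The offset encodes whether \<open>j \<in> A\<close>. Being positive, it makes up for the
  rounding down in \<open>growth\<close>; being at most 2, it fits into the constant
  \<open>c\<close>.\<close>

primrec exponents :: "ereal \<Rightarrow> nat set \<Rightarrow> nat \<Rightarrow> nat" where
  "exponents \<tau> A 0 = 1"
| "exponents \<tau> A (Suc j) = growth \<tau> j (exponents \<tau> A j) + (if j \<in> A then 1 else 2)"

lemma doubling_exponents:
  assumes "2 \<le> \<tau>"
  shows "doubling_sequence (exponents \<tau> A)"
proof
  fix j
  let ?n = "exponents \<tau> A j"
  have "2 * ?n \<le> growth \<tau> j ?n"
  proof (cases "\<tau> = \<infinity>")
    case False
    then have "2 \<le> real_of_ereal \<tau>"
      using assms by (cases \<tau>) auto
    then have "2 * real ?n \<le> real_of_ereal \<tau> * real ?n"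
      by (intro mult_right_mono) auto
    then show ?thesis using False by (simp add: growth_def) linarith
  qed (simp add: growth_def)
  then show "2 * ?n < exponents \<tau> A (Suc j)" by simp
qed simp

lemma strict_mono_range_eq:
  fixes f g :: "nat \<Rightarrow> nat"
  assumes "strict_mono f" "strict_mono g" "range f = range g"
  shows "f = g"
proof -
  have le: "f n \<le> g n" if "strict_mono f" "strict_mono g" "range g \<subseteq> range f"
    for f g :: "nat \<Rightarrow> nat" and n
  proof -
    \<comment> \<open>\<open>k i\<close> is the position of \<open>g i\<close> in the enumeration
      \<open>f\<close>; it is strictly increasing, so \<open>n \<le> k n\<close>.\<close>
    define k where "k = inv f \<circ> g"
    have k: "f (k i) = g i" for i
      using that(3) by (simp add: k_def f_inv_into_f range_subsetD)
    have "strict_mono k"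
      by (rule strict_monoI) (metis k strict_mono_less that(1,2))
    then have "f n \<le> f (k n)"
      using strict_mono_imp_increasing that(1) by (simp add: strict_mono_less_eq)
    then show ?thesis by (simp add: k)
  qed
  show ?thesis
    using le[of f g] le[of g f] assms by (intro ext antisym) auto
qed

lemma inj_exponents: "inj (exponents \<tau>)"
proof (rule injI)
  fix A B
  assume eq: "exponents \<tau> A = exponents \<tau> B"
  have "j \<in> A \<longleftrightarrow> j \<in> B" for j
    using fun_cong[OF eq, of "Suc j"] fun_cong[OF eq, of j] by (simp split: if_splits)
  then show "A = B" by blast
qed

lemma inj_lacunary_exponents:
  assumes "2 \<le> \<tau>"
  shows "inj (\<lambda>A. lacunary (exponents \<tau> A) :: 'a::field fls)"
proof (rule injI)
  fix A B
  assume eq: "lacunary (exponents \<tau> A) = (lacunary (exponents \<tau> B) :: 'a fls)"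
  have "n \<in> range (exponents \<tau> A) \<longleftrightarrow> n \<in> range (exponents \<tau> B)" for n
    using arg_cong[OF eq, of "\<lambda>f. fls_nth f (int n)"]
    by (simp add: lacunary_nth_int split: if_splits)
  then have "exponents \<tau> A = exponents \<tau> B"
    using doubling_sequence.strict_mono_m[OF doubling_exponents[OF assms]]
    by (intro strict_mono_range_eq) auto
  then show "A = B" using inj_exponents by (simp add: inj_eq)
qed

lemma infinite_approximations_exponents:
  assumes "2 \<le> \<tau>" "ereal t \<le> \<tau>"
  shows "infinite (approximations (lacunary (exponents \<tau> A) :: 'a::field fls) t)"
proof (rule doubling_sequence.infinite_approximations[OF doubling_exponents[OF assms(1)]])
  show "\<forall>\<^sub>F j in sequentially. t * real (exponents \<tau> A j) < real (exponents \<tau> A (Suc j))"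
  proof (rule eventually_sequentiallyI)
    fix j :: nat
    assume j: "nat \<lceil>t\<rceil> \<le> j"
    let ?n = "exponents \<tau> A j"
    \<comment> \<open>The 1 is the smaller offset. It makes the inequality strict even for
      \<open>t = \<tau>\<close>.\<close>
    have "t * real ?n < real (growth \<tau> j ?n) + 1"
    proof (cases "\<tau> = \<infinity>")
      case True
      have "t * real ?n \<le> real (j + 2) * real ?n"
        using j by (intro mult_right_mono) linarith+
      then show ?thesis using True by (simp add: growth_def algebra_simps)
    next
      case False
      then have "t \<le> real_of_ereal \<tau>"
        using assms by (cases \<tau>) auto
      then have "t * real ?n \<le> real_of_ereal \<tau> * real ?n"
        by (intro mult_right_mono) auto
      then show ?thesis using False by (simp add: growth_def) linarith
    qed
    then show "t * real ?n < real (exponents \<tau> A (Suc j))" by simp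
  qed
qed

lemma finite_approximations_exponents:
  assumes "finite (UNIV :: 'a::field set)" "2 \<le> \<tau>" "\<tau> < ereal t"
  shows "finite (approximations (lacunary (exponents \<tau> A) :: 'a fls) t)"
proof -
  have fin: "\<tau> \<noteq> \<infinity>" using assms(3) by auto
  define s where "s = real_of_ereal \<tau>"
  have s: "2 \<le> s" "s < t"
    using assms(2,3) by (cases \<tau>; simp add: s_def)+
  show ?thesis
  proof (rule doubling_sequence.finite_approximations
      [OF doubling_exponents[OF assms(2)] assms(1) s(1) _ _ s(2)])
    fix j
    have "0 \<le> s * real (exponents \<tau> A j)" using s(1) by simp
    then have "real (growth \<tau> j (exponents \<tau> A j)) \<le> s * real (exponents \<tau> A j)"
      using fin by (simp add: growth_def s_def)
    then show "real (exponents \<tau> A (Suc j)) \<le> s * real (exponents \<tau> A j) + 2" by simp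
  qed simp
qed

lemma irrationality_exponent_lacunary:
  assumes "finite (UNIV :: 'a::field set)" "2 \<le> \<tau>"
  shows "irrationality_exponent (lacunary (exponents \<tau> A) :: 'a fls) = \<tau>"
proof -
  let ?f = "lacunary (exponents \<tau> A) :: 'a fls"
  \<comment> \<open>The endpoint \<open>t = \<tau>\<close> is included when \<open>\<tau>\<close> is
    finite; for \<open>\<tau> = \<infinity>\<close> both sets contain every real.\<close>
  have "{ereal t | t. infinite (approximations ?f t)} = {ereal t | t. ereal t \<le> \<tau>}"
    using infinite_approximations_exponents[OF assms(2), where 'a = 'a]
      finite_approximations_exponents[OF assms]
    by (metis (no_types, opaque_lifting) linorder_not_le)
  moreover have "Sup {ereal t | t. ereal t \<le> \<tau>} = \<tau>"
  proof (rule antisym)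
    show "Sup {ereal t | t. ereal t \<le> \<tau>} \<le> \<tau>"
      by (rule Sup_least) auto
    show "\<tau> \<le> Sup {ereal t | t. ereal t \<le> \<tau>}"
    proof (rule dense_le)
      fix x
      assume "x < \<tau>"
      then obtain t where "x < ereal t" "ereal t < \<tau>"
        using ereal_dense2 by blast
      then show "x \<le> Sup {ereal t | t. ereal t \<le> \<tau>}"
        by (intro Sup_upper2[of "ereal t"]) auto
    qed
  qed
  ultimately show ?thesis by (simp add: irrationality_exponent_def)
qed

text \<open>Translation by 1 permutes the field, so summing \<open>x + 1\<close> and
  \<open>x\<close> over it gives the same value, whence \<open>3 = 0\<close>.\<close>

lemma two_eq_minus_one:
  assumes "card (UNIV :: 'a::field set) = 3"
  shows "(2 :: 'a) = - 1"
proof -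
  have "(\<Sum>x\<in>UNIV. x + 1) = (\<Sum>x\<in>UNIV. x :: 'a)"
    by (rule sum.reindex_bij_witness[of _ "\<lambda>x. x - 1" "\<lambda>x. x + 1"]) auto
  then have "(3 :: 'a) = 0"
    using assms by (simp add: sum.distrib)
  then show ?thesis by (simp add: eq_neg_iff_add_eq_0)
qed

lemma lacunary_in_cantor_set:
  assumes "card (UNIV :: 'a::field set) = 3" "\<And>j. 0 < m j"
  shows "(lacunary m :: 'a fls) \<in> cantor_set"
  using two_eq_minus_one[OF assms(1)] by (auto simp: cantor_set_def lacunary_nth assms(2) not_le)

theorem corollary9:
  fixes \<tau> :: ereal
  assumes "card (UNIV :: 'a::field set) = 3"
    and "2 \<le> \<tau>"
  shows "uncountable {\<xi> \<in> (cantor_set :: 'a fls set). irrationality_exponent \<xi> = \<tau>}"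
proof
  let ?S = "{\<xi> \<in> (cantor_set :: 'a fls set). irrationality_exponent \<xi> = \<tau>}"
  assume "countable ?S"
  moreover have "finite (UNIV :: 'a set)"
    using assms(1) by (simp add: card_ge_0_finite)
  then have "range (\<lambda>A. lacunary (exponents \<tau> A)) \<subseteq> ?S"
    using assms doubling_sequence.m_pos[OF doubling_exponents[OF assms(2)]]
    by (auto intro!: lacunary_in_cantor_set irrationality_exponent_lacunary)
  ultimately have "countable (range (\<lambda>A. lacunary (exponents \<tau> A) :: 'a fls))"
    by (rule countable_subset[rotated])
  \<comment> \<open>Distinct sets \<open>A\<close> give distinct series, so countability would pass
    to the power set of the naturals.\<close>
  then have "countable (UNIV :: nat set set)"
    using inj_lacunary_exponents[OF assms(2)] by (rule countable_image_inj_on)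
  then show False
    using Cantors_theorem[of "UNIV :: nat set"] uncountable_def[of "UNIV :: nat set set"] by auto
qed

end
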